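(* Let $X$ be a finite set with $n \geq 2$ elements, let $p,q\in\mathbb{R}$ with $q \geq \frac{p}{2} > 0$, and let $\mathcal{S}$ be a maximum compatible split system on $X$ together with a strictly positive weighting $\omega:\mathcal{S}\to\mathbb{R}_{>0}$. Put $D = D_{(\mathcal{S},\omega)}$. Then there exists a non-negative weighting $\omega':\mathcal{S}\to\mathbb{R}_{\geq 0}$ such that $O_{p,q}(D) = D_{(\mathcal{S},\omega')}$.
   Context: A distance on a finite non-empty set $X$ is a symmetric map $D: X\times X\to\mathbb{R}$ with $D(x,x)=0$ and $D(x,y)\geq 0$ for all $x,y\in X$. A split of $X$ is a bipartition $\{A,B\}$ of $X$ into two non-empty sets, written $A|B$; a split system on $X$ is a non-empty set of splits of $X$. For a split $S=A|B$, $D_S$ is the distance with $D_S(x,y)=1$ if $|A\cap\{x,y\}|=|B\cap\{x,y\}|=1$ and $D_S(x,y)=0$ otherwise. For a split system $\mathcal{S}$ and a weighting $\omega:\mathcal{S}\to\mathbb{R}_{\geq 0}$, $D_{(\mathcal{S},\omega)}=\sum_{S\in\mathcal{S}}\omega(S)D_S$. For a distance $D$ and $u\neq v$ in $X$ let $X_{u,v}=\{x\in X: D(u,x)<D(v,x)\}$ and $E_{\{u,v\}}=\{x\in X: D(u,x)=D(v,x)\}$. For $q\geq \frac p2>0$ the order distance is $$O_{p,q}(D)=\sum_{\substack{(u,v)\in X\times X,\ u\neq v\\ \emptyset\subsetneq X_{u,v}\subsetneq X}}\tfrac{p}{2}\, D_{X_{u,v}|X-X_{u,v}} \;+\; \sum_{\substack{\{u,v\}\subseteq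 X,\ u\ne v\\ \emptyset\subsetneq E_{\{u,v\}}\subsetneq X}}\left(q-\tfrac p2\right) D_{E_{\{u,v\}}|X-E_{\{u,v\}}}.$$ A split system is compatible if for any two of its splits $A_1|B_1$, $A_2|B_2$ at least one of $A_1\cap A_2$, $A_1\cap B_2$, $B_1\cap A_2$, $B_1\cap B_2$ is empty. A compatible split system on an $n$-element set is maximum if it has the maximum possible size $2n-3$ (equivalently, it is maximal under inclusion among compatible split systems). *)

theory Defs
  imports Complex_Main "HOL-Library.Disjoint_Sets"
begin

(* A split A|B of X is encoded as the unordered pair {A, B}, a set of sets. Distances and
   weightings are total functions of which only the values on X and on the split system matter. *)

definition is_split :: "'a set \<Rightarrow> 'a set set \<Rightarrow> bool" where
  "is_split X S \<longleftrightarrow> partition_on X S \<and> card S = 2"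

definition split_system :: "'a set \<Rightarrow> 'a set set set \<Rightarrow> bool" where
  "split_system X \<S> \<longleftrightarrow> \<S> \<noteq> {} \<and> (\<forall>S\<in>\<S>. is_split X S)"

definition compatible_splits :: "'a set set set \<Rightarrow> bool" where
  "compatible_splits \<S> \<longleftrightarrow> (\<forall>S\<in>\<S>. \<forall>T\<in>\<S>. \<exists>A\<in>S. \<exists>B\<in>T. A \<inter> B = {})"

(* The largest size of a compatible split system on n \<ge> 2 points is 2 n - 3. *)
definition maximum_compatible :: "'a set \<Rightarrow> 'a set set set \<Rightarrow> bool" where
  "maximum_compatible X \<S> \<longleftrightarrow>
     split_system X \<S> \<and> compatible_splits \<S> \<and> card \<S> = 2 * card X - 3"

definition split_dist :: "'a set set \<Rightarrow> 'a \<Rightarrow> 'a \<Rightarrow> real" where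
  "split_dist S x y = (if \<forall>A\<in>S. card (A \<inter> {x, y}) = 1 then 1 else 0)"

definition weighted_split_dist ::
    "'a set set set \<Rightarrow> ('a set set \<Rightarrow> real) \<Rightarrow> 'a \<Rightarrow> 'a \<Rightarrow> real" where
  "weighted_split_dist \<S> \<omega> x y = (\<Sum>S\<in>\<S>. \<omega> S * split_dist S x y)"

definition closer :: "'a set \<Rightarrow> ('a \<Rightarrow> 'a \<Rightarrow> real) \<Rightarrow> 'a \<Rightarrow> 'a \<Rightarrow> 'a set" where
  "closer X D u v = {x\<in>X. D u x < D v x}"

(* Takes the unordered pair P = {u, v} as argument; then it is {x \<in> X. D u x = D v x}. *)
definition equidistant :: "'a set \<Rightarrow> ('a \<Rightarrow> 'a \<Rightarrow> real) \<Rightarrow> 'a set \<Rightarrow> 'a set" where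
  "equidistant X D P = {x\<in>X. \<forall>u\<in>P. \<forall>v\<in>P. D u x = D v x}"

(* The first sum ranges over ordered pairs (u, v), the second over unordered pairs {u, v}. *)
definition order_distance ::
    "'a set \<Rightarrow> real \<Rightarrow> real \<Rightarrow> ('a \<Rightarrow> 'a \<Rightarrow> real) \<Rightarrow> 'a \<Rightarrow> 'a \<Rightarrow> real" where
  "order_distance X p q D x y =
     (\<Sum>(u, v) \<in> {(u, v) \<in> X \<times> X. u \<noteq> v \<and> {} \<subset> closer X D u v \<and> closer X D u v \<subset> X}.
        p / 2 * split_dist {closer X D u v, X - closer X D u v} x y) +
     (\<Sum>P \<in> {P. P \<subseteq> X \<and> card P = 2 \<and> {} \<subset> equidistant X D P \<and> equidistant X D P \<subset> X}.
        (q - p / 2) * split_dist {equidistant X D P, X - equidistant X D P} x y)"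

end

theory Submission
  imports Defs
begin

(* For u, v in X the blocks that contain u but not v form a chain under inclusion, and
   D u x - D v x grows strictly each time x leaves a member of the chain. So the proper non-empty
   sublevel sets of D u - D v are themselves blocks of the split system; in particular this holds for
   the set of points closer to u than to v. The set of equidistant points is the difference of two
   consecutive members of the chain, which makes its split compatible with the whole system; since
   no compatible system has more than 2 n - 3 splits, it belongs to the system already. Hence every
   split in the order distance lies in the system, and its coefficients only need to be collected. *)

section \<open>Blocks of splits\<close>

lemma is_split_pair_iff:
  "is_split X {A, X - A} \<longleftrightarrow> A \<noteq> {} \<and> A \<subset> X" if "A \<subseteq> X"
  using that by (auto simp: is_split_def partition_on_def disjoint_def card_insert_if)

lemma is_split_block:
  assumes "is_split X S" "A \<in> S"
  shows "S = {A, X - A}" "A \<noteq> {}" "A \<subset> X"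
proof -
  have part: "partition_on X S" and "card S = 2"
    using assms(1) by (auto simp: is_split_def)
  then obtain B where S: "S = {A, B}" and "A \<noteq> B"
    using assms(2) unfolding card_2_iff by (metis doubleton_eq_iff insertE singletonD)
  then have AB: "A \<inter> B = {}" "A \<union> B = X" "{} \<noteq> A" "{} \<noteq> B"
    using part by (simp_all add: partition_on_def disjoint_def)
  then have "B = X - A"
    by blast
  with S AB show "S = {A, X - A}" "A \<noteq> {}" "A \<subset> X"
    by auto
qed

lemma is_split_obtain_block:
  assumes "is_split X S" "x \<in> X"
  obtains A where "A \<in> S" "x \<in> A"
  using assms by (auto simp: is_split_def partition_on_def)

lemma split_dist_block:
  assumes "is_split X S" "A \<in> S" "x \<in> X" "y \<in> X"
  shows "split_dist S x y = (if x \<in> A \<longleftrightarrow> y \<in> A then 0 else 1)"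
proof -
  \<comment> \<open>For \<open>x = y\<close> the set \<open>{x, y}\<close> is a singleton and meets
    only one of the two complementary blocks, so this case yields 0 as well.\<close>
  have "card (B \<inter> {x, y}) = 1 \<longleftrightarrow> (if x = y then x \<in> B else (x \<in> B) \<noteq> (y \<in> B))" for B
    by (cases "x \<in> B"; cases "y \<in> B") auto
  moreover have "S = {A, X - A}"
    using is_split_block(1)[OF assms(1,2)] .
  ultimately show ?thesis
    using assms(3,4) by (simp add: split_dist_def)
qed

lemma weighted_split_dist_commute:
  "weighted_split_dist \<S> \<omega> x y = weighted_split_dist \<S> \<omega> y x"
  by (simp add: weighted_split_dist_def split_dist_def insert_commute)

text \<open>Compatibility of two splits, expressed through one block of each: the four alternatives
  are the four possible empty intersections. For subsets of \<open>X\<close> the relation is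
  unchanged when a block is replaced by its complement.\<close>

definition nested :: "'a set \<Rightarrow> 'a set \<Rightarrow> 'a set \<Rightarrow> bool" where
  "nested X A B \<longleftrightarrow> A \<inter> B = {} \<or> A \<subseteq> B \<or> B \<subseteq> A \<or> A \<union> B = X"

lemma disjoint_blocks_iff_nested:
  assumes "A \<subseteq> X" "B \<subseteq> X"
  shows "(\<exists>A'\<in>{A, X - A}. \<exists>B'\<in>{B, X - B}. A' \<inter> B' = {}) \<longleftrightarrow> nested X A B"
proof -
  have "A \<inter> (X - B) = {} \<longleftrightarrow> A \<subseteq> B" "(X - A) \<inter> B = {} \<longleftrightarrow> B \<subseteq> A"
    "(X - A) \<inter> (X - B) = {} \<longleftrightarrow> A \<union> B = X"
    using assms by auto
  then show ?thesis
    by (simp add: nested_def disj_ac)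
qed

lemma compatible_nested:
  assumes "compatible_splits \<S>" "\<And>S. S \<in> \<S> \<Longrightarrow> is_split X S"
    and "S \<in> \<S>" "T \<in> \<S>" "A \<in> S" "B \<in> T"
  shows "nested X A B"
proof -
  have "S = {A, X - A}" "A \<subseteq> X" "T = {B, X - B}" "B \<subseteq> X"
    using is_split_block(1,3)[OF assms(2)[OF assms(3)] assms(5)]
      is_split_block(1,3)[OF assms(2)[OF assms(4)] assms(6)] by auto
  then show ?thesis
    using assms(1,3,4) disjoint_blocks_iff_nested[of A X B]
    unfolding compatible_splits_def by metis
qed

text \<open>One block per old split is enough, because nestedness does not depend on which block is
  chosen. The new split is compatible with itself since \<open>E\<close> and \<open>X - E\<close>
  are disjoint.\<close>

lemma compatible_insert:
  assumes "compatible_splits \<S>" "\<And>S. S \<in> \<S> \<Longrightarrow> is_split X S" "E \<subseteq> X"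
    and "\<And>S. S \<in> \<S> \<Longrightarrow> \<exists>A\<in>S. nested X A E"
  shows "compatible_splits (insert {E, X - E} \<S>)"
proof -
  define disj where "disj S T \<longleftrightarrow> (\<exists>A\<in>S. \<exists>B\<in>T. A \<inter> B = {})" for S T :: "'a set set"
  have compat_iff: "compatible_splits \<T> \<longleftrightarrow> (\<forall>S\<in>\<T>. \<forall>T\<in>\<T>. disj S T)" for \<T>
    by (simp add: compatible_splits_def disj_def)
  have "disj S {E, X - E}" if S: "S \<in> \<S>" for S
  proof -
    obtain A where "A \<in> S" "nested X A E"
      using assms(4)[OF S] by blast
    moreover have "S = {A, X - A}" "A \<subseteq> X"
      using is_split_block[OF assms(2)[OF S] \<open>A \<in> S\<close>] by auto
    ultimately show ?thesis
      using disjoint_blocks_iff_nested[of A X E] assms(3) unfolding disj_def by simp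
  qed
  moreover have "disj S T \<longleftrightarrow> disj T S" for S T
    unfolding disj_def by (metis inf_commute)
  moreover have "disj {E, X - E} {E, X - E}"
    by (simp add: disj_def)
  ultimately show ?thesis
    using assms(1) unfolding compat_iff by (metis insert_iff)
qed

section \<open>Maximality of maximum compatible split systems\<close>

text \<open>Every member other than \<open>Y\<close> lies inside a maximal such member
  \<open>A\<close> or inside \<open>Y - A\<close>. Induction on both parts gives
  \<open>(2 a - 1) + (2 b - 1) + 1 = 2 (a + b) - 1\<close>, where \<open>a\<close> and
  \<open>b\<close> are the sizes of the parts.\<close>

lemma card_laminar_le:
  assumes "finite Y" "Y \<noteq> {}" "F \<subseteq> Pow Y - {{}}"
    and "\<And>A B. A \<in> F \<Longrightarrow> B \<in> F \<Longrightarrow> A \<inter> B = {} \<or> A \<subseteq> B \<or> B \<subseteq> A"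
  shows "card F \<le> 2 * card Y - 1"
  using assms
proof (induction "card Y" arbitrary: Y F rule: less_induct)
  case less
  have cardY: "card Y \<ge> 1"
    using less.prems by (simp add: Suc_leI card_gt_0_iff)
  have finF: "finite F"
    using less.prems(1,3) by (meson finite_Diff finite_Pow_iff finite_subset)
  show ?case
  proof (cases "F \<subseteq> {Y}")
    case True
    then have "card F \<le> 1"
      using card_mono[of "{Y}" F] by simp
    then show ?thesis
      using cardY by linarith
  next
    case False
    then obtain A where A: "A \<in> F - {Y}"
      and Amax: "\<And>B. B \<in> F - {Y} \<Longrightarrow> A \<subseteq> B \<Longrightarrow> A = B"
      using finite_has_maximal[of "F - {Y}"] finF by auto
    have "A \<noteq> {}" "A \<subset> Y"
      using A less.prems(3) by auto
    define F1 F2 where "F1 = F \<inter> Pow A" and "F2 = F \<inter> Pow (Y - A)"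
    have "B \<in> F1 \<union> F2" if "B \<in> F - {Y}" for B
      using less.prems(4)[of A B] Amax[of B] that A less.prems(3) unfolding F1_def F2_def by auto
    then have "F \<subseteq> insert Y (F1 \<union> F2)"
      by blast
    then have "card F \<le> card (insert Y (F1 \<union> F2))"
      using finF by (intro card_mono) (auto simp: F1_def F2_def)
    also have "\<dots> \<le> Suc (card F1 + card F2)"
      using card_Un_le[of F1 F2] finF by (simp add: card_insert_if F1_def F2_def)
    finally have "card F \<le> Suc (card F1 + card F2)" .
    moreover have "card F1 \<le> 2 * card A - 1"
      using \<open>A \<noteq> {}\<close> \<open>A \<subset> Y\<close> less.prems
      by (intro less.hyps) (auto simp: F1_def psubset_card_mono intro: finite_subset)
    moreover have "card F2 \<le> 2 * card (Y - A) - 1"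
      using \<open>A \<noteq> {}\<close> \<open>A \<subset> Y\<close> less.prems
      by (intro less.hyps psubset_card_mono) (auto simp: F2_def)
    moreover have "finite A"
      using \<open>A \<subset> Y\<close> less.prems(1) finite_subset by blast
    then have "card A \<ge> 1" "card (Y - A) = card Y - card A" "card A < card Y"
      using \<open>A \<noteq> {}\<close> \<open>A \<subset> Y\<close> less.prems(1)
      by (auto simp: Suc_le_eq card_gt_0_iff card_Diff_subset psubset_card_mono)
    ultimately show ?thesis
      by linarith
  qed
qed

text \<open>Sending each split to its block that avoids a fixed point gives a laminar family.\<close>

lemma card_compatible_le:
  assumes "finite X" "card X \<ge> 2"
    and "compatible_splits \<S>" and split: "\<And>S. S \<in> \<S> \<Longrightarrow> is_split X S"
  shows "card \<S> \<le> 2 * card X - 3"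
proof -
  obtain r where "r \<in> X"
    using assms(2) by fastforce
  define F where "F = {A \<in> \<Union>\<S>. r \<notin> A}"
  have "\<S> \<subseteq> (\<lambda>A. {A, X - A}) ` F"
  proof
    fix S assume "S \<in> \<S>"
    then obtain A where "A \<in> S" "r \<in> A"
      using is_split_obtain_block[of X S r] split \<open>r \<in> X\<close> by blast
    then have "S = {X - A, X - (X - A)}"
      using is_split_block[of X S A] split[OF \<open>S \<in> \<S>\<close>] by (auto simp: double_diff)
    then show "S \<in> (\<lambda>A. {A, X - A}) ` F"
      using \<open>S \<in> \<S>\<close> \<open>r \<in> A\<close> unfolding F_def by blast
  qed
  moreover have Fsub: "F \<subseteq> Pow (X - {r}) - {{}}"
  proof
    fix A assume "A \<in> F"
    then obtain S where "S \<in> \<S>" "A \<in> S" "r \<notin> A"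
      by (auto simp: F_def)
    then show "A \<in> Pow (X - {r}) - {{}}"
      using is_split_block(2,3)[OF split[of S], of A] by auto
  qed
  then have "finite F"
    using assms(1) by (meson finite_Diff finite_Pow_iff finite_subset)
  ultimately have "card \<S> \<le> card F"
    by (meson surj_card_le)
  \<comment> \<open>The family lives on \<open>n - 1\<close> points, and
    \<open>2 (n - 1) - 1\<close> is \<open>2 n - 3\<close>.\<close>
  also have "card F \<le> 2 * card (X - {r}) - 1"
  proof (rule card_laminar_le[OF _ _ Fsub])
    show "finite (X - {r})"
      using assms(1) by simp
    show "X - {r} \<noteq> {}"
      using assms(1,2) card_mono[of "{r}" X] by auto
    show "A \<inter> B = {} \<or> A \<subseteq> B \<or> B \<subseteq> A" if "A \<in> F" "B \<in> F" for A B
    proof -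
      \<comment> \<open>The point \<open>r\<close> of \<open>X\<close> rules out the alternative
        that \<open>A\<close> and \<open>B\<close> cover \<open>X\<close>.\<close>
      have "nested X A B" "r \<notin> A \<union> B"
        using that compatible_nested[OF assms(3) split] by (auto simp: F_def)
      then show ?thesis
        using \<open>r \<in> X\<close> by (auto simp: nested_def)
    qed
  qed
  finally show ?thesis
    using \<open>r \<in> X\<close> assms(1,2) by simp
qed

text \<open>Otherwise adjoining the split would give a compatible system of \<open>2 n - 2\<close>
  splits, one above the bound.\<close>

lemma maximum_compatible_maximal:
  assumes "finite X" "card X \<ge> 2" "maximum_compatible X \<S>"
    and "E \<noteq> {}" "E \<subset> X" and "\<And>S. S \<in> \<S> \<Longrightarrow> \<exists>A\<in>S. nested X A E"
  shows "{E, X - E} \<in> \<S>"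
proof (rule ccontr)
  assume notin: "{E, X - E} \<notin> \<S>"
  have split: "is_split X S" if "S \<in> \<S>" for S
    using assms(3) that by (auto simp: maximum_compatible_def split_system_def)
  have card: "card \<S> = 2 * card X - 3" and compat: "compatible_splits \<S>"
    using assms(3) by (auto simp: maximum_compatible_def)
  \<comment> \<open>An infinite set has \<open>card\<close> 0, whereas \<open>2 * card X - 3\<close>
    is positive.\<close>
  then have "finite \<S>"
    using assms(2) by (intro card_ge_0_finite) simp
  have "is_split X {E, X - E}"
    using assms(5) is_split_pair_iff[of E X] assms(4) by auto
  then have "card (insert {E, X - E} \<S>) \<le> 2 * card X - 3"
    using assms(5,6) split
    by (intro card_compatible_le[OF assms(1,2) compatible_insert[OF compat split]]) auto
  then show False
    using notin card \<open>finite \<S>\<close> by simp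
qed

section \<open>Sublevel sets of differences of distances\<close>

locale weighted_compatible_system =
  fixes X :: "'a set" and \<S> :: "'a set set set" and \<omega> :: "'a set set \<Rightarrow> real"
  assumes finX: "finite X" and finS: "finite \<S>"
    and split: "\<And>S. S \<in> \<S> \<Longrightarrow> is_split X S"
    and compat: "compatible_splits \<S>"
    and pos: "\<And>S. S \<in> \<S> \<Longrightarrow> \<omega> S > 0"
begin

abbreviation "dist_diff u v x \<equiv> weighted_split_dist \<S> \<omega> u x - weighted_split_dist \<S> \<omega> v x"

text \<open>For \<open>u\<close> and \<open>v\<close> in \<open>X\<close> these are the edges on the
  path from \<open>u\<close> to \<open>v\<close> in the tree that represents the compatible system,
  each given by its side of \<open>u\<close>.\<close>

definition chain :: "'a \<Rightarrow> 'a \<Rightarrow> 'a set set" where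
  "chain u v = {A \<in> \<Union>\<S>. u \<in> A \<and> v \<notin> A}"

lemma chain_block:
  assumes "A \<in> chain u v"
  shows "{A, X - A} \<in> \<S>" "A \<subset> X"
proof -
  obtain S where S: "S \<in> \<S>" "A \<in> S"
    using assms by (auto simp: chain_def)
  then show "{A, X - A} \<in> \<S>" "A \<subset> X"
    using is_split_block(1,3)[OF split[OF S(1)] S(2)] by auto
qed

lemma chain_total:
  assumes "v \<in> X" "A \<in> chain u v" "B \<in> chain u v"
  shows "A \<subseteq> B \<or> B \<subseteq> A"
proof -
  have "nested X A B" "u \<in> A \<inter> B" "v \<notin> A \<union> B"
    using assms compatible_nested[OF compat split] by (auto simp: chain_def)
  then show ?thesis
    using \<open>v \<in> X\<close> by (auto simp: nested_def)
qed

text \<open>A split that does not separate \<open>u\<close> from \<open>v\<close> contributes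
  equally to both distances; a separating one contributes to exactly one of them.\<close>

lemma split_dist_diff_chain:
  assumes "u \<in> X" "v \<in> X" "x \<in> X" "S \<in> \<S>" "A \<in> S" "u \<in> A"
  shows "split_dist S u x - split_dist S v x =
    (if A \<in> chain u v then if x \<in> A then -1 else 1 else 0)"
  using assms split_dist_block[OF split[OF assms(4)] assms(5)] by (auto simp: chain_def)

lemma dist_diff_sum:
  "dist_diff u v x = (\<Sum>S\<in>\<S>. \<omega> S * (split_dist S u x - split_dist S v x))"
  by (simp add: weighted_split_dist_def sum_subtractf right_diff_distrib)

lemma weighted_split_dist_self:
  assumes "x \<in> X"
  shows "weighted_split_dist \<S> \<omega> x x = 0"
  unfolding weighted_split_dist_def
proof (rule sum.neutral, rule ballI)
  fix S assume S: "S \<in> \<S>"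
  obtain A where "A \<in> S"
    using is_split_obtain_block[OF split[OF S] assms] by blast
  then show "\<omega> S * split_dist S x x = 0"
    using split_dist_block[OF split[OF S] _ assms assms] by simp
qed

text \<open>The summand of a chain block \<open>A\<close> is minus its weight on \<open>A\<close>
  and plus its weight outside. As the blocks form a chain, two points cannot be separated in both
  directions, so no summands work against each other.\<close>

lemma dist_diff_less_iff:
  assumes "u \<in> X" "v \<in> X" "x \<in> X" "y \<in> X"
  shows "dist_diff u v x < dist_diff u v y \<longleftrightarrow> (\<exists>A\<in>chain u v. x \<in> A \<and> y \<notin> A)"
proof -
  \<comment> \<open>The points are quantified afresh because one direction below uses this with
    \<open>x\<close> and \<open>y\<close> exchanged.\<close>
  have mono: "\<omega> S * (split_dist S u x - split_dist S v x)
      \<le> \<omega> S * (split_dist S u y - split_dist S v y)"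
    if no: "\<not> (\<exists>A\<in>chain u v. y \<in> A \<and> x \<notin> A)" and S: "S \<in> \<S>"
      and "x \<in> X" "y \<in> X" for x y S
  proof -
    obtain A where "A \<in> S" "u \<in> A"
      using is_split_obtain_block[OF split[OF S] assms(1)] .
    then show ?thesis
      using no S split_dist_diff_chain[OF assms(1,2)] that(3,4) pos[OF S]
      by (intro mult_left_mono) auto
  qed
  show ?thesis
  proof
    assume less: "dist_diff u v x < dist_diff u v y"
    show "\<exists>A\<in>chain u v. x \<in> A \<and> y \<notin> A"
    proof (rule ccontr)
      assume "\<not> (\<exists>A\<in>chain u v. x \<in> A \<and> y \<notin> A)"
      then have "dist_diff u v y \<le> dist_diff u v x"
        unfolding dist_diff_sum using assms by (intro sum_mono mono) auto
      with less show False by simp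
    qed
  next
    assume "\<exists>A\<in>chain u v. x \<in> A \<and> y \<notin> A"
    then obtain A where A: "A \<in> chain u v" "x \<in> A" "y \<notin> A"
      by blast
    then have no: "\<not> (\<exists>B\<in>chain u v. y \<in> B \<and> x \<notin> B)"
      using chain_total[OF assms(2)] by blast
    obtain S where S: "S \<in> \<S>" "A \<in> S" "u \<in> A"
      using A(1) by (auto simp: chain_def)
    have "\<omega> S * (split_dist S u x - split_dist S v x)
      < \<omega> S * (split_dist S u y - split_dist S v y)"
      using split_dist_diff_chain[OF assms(1,2) _ S] assms A pos[OF S(1)] by simp
    then show "dist_diff u v x < dist_diff u v y"
      unfolding dist_diff_sum using mono[OF no] finS S(1) assms
      by (intro sum_strict_mono_ex1) auto
  qed
qed

text \<open>Let \<open>x\<close> maximize the difference on \<open>L\<close> and \<open>y\<close>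
  minimize it outside. A chain block separating them must equal \<open>L\<close>: a point of
  \<open>L\<close> outside the block would have a value above that of \<open>x\<close>, a point of
  the block outside \<open>L\<close> one below that of \<open>y\<close>.\<close>

lemma sublevel_in_chain:
  assumes "u \<in> X" "v \<in> X" "L \<subset> X" "L \<noteq> {}"
    and lower: "\<And>x y. x \<in> L \<Longrightarrow> y \<in> X - L \<Longrightarrow> dist_diff u v x < dist_diff u v y"
  shows "L \<in> chain u v"
proof -
  have fin: "finite L" "finite (X - L)" and "X - L \<noteq> {}"
    using finX assms(3) finite_subset by auto
  define f where "f = dist_diff u v"
  obtain x where "x \<in> L" "f x = Max (f ` L)"
    using Max_in[of "f ` L"] fin(1) assms(4) by fastforce
  then have x: "x \<in> L" "\<And>z. z \<in> L \<Longrightarrow> f z \<le> f x"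
    using fin(1) by simp_all
  obtain y where "y \<in> X - L" "f y = Min (f ` (X - L))"
    using Min_in[of "f ` (X - L)"] fin(2) \<open>X - L \<noteq> {}\<close> by fastforce
  then have y: "y \<in> X - L" "\<And>z. z \<in> X - L \<Longrightarrow> f y \<le> f z"
    using fin(2) by simp_all
  have less_iff: "f a < f b \<longleftrightarrow> (\<exists>A\<in>chain u v. a \<in> A \<and> b \<notin> A)" if "a \<in> X" "b \<in> X" for a b
    using dist_diff_less_iff[OF assms(1,2) that] by (simp add: f_def)
  have xyX: "x \<in> X" "y \<in> X"
    using x(1) y(1) assms(3) by auto
  obtain A where A: "A \<in> chain u v" "x \<in> A" "y \<notin> A"
    using lower[OF x(1) y(1)] less_iff[OF xyX] by (auto simp: f_def)
  have "z \<in> A" if "z \<in> L" for z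
    using x(2)[OF that] less_iff[of x z] xyX assms(3) A that by (meson not_le psubsetD)
  moreover have "z \<notin> A" if "z \<in> X - L" for z
    using y(2)[OF that] less_iff[of z y] xyX A that by (meson DiffD1 not_le)
  ultimately have "A = L"
    using chain_block(2)[OF A(1)] assms(3) by blast
  with A(1) show ?thesis by simp
qed

lemma closer_split:
  assumes "u \<in> X" "v \<in> X" "C = closer X (weighted_split_dist \<S> \<omega>) u v" "C \<noteq> {}" "C \<subset> X"
  shows "{C, X - C} \<in> \<S>"
proof -
  have "C \<in> chain u v"
    using assms(3-5) by (intro sublevel_in_chain assms) (auto simp: closer_def)
  then show ?thesis
    by (rule chain_block(1))
qed

lemma equidistant_nested:
  assumes "u \<in> X" "v \<in> X" "E = {x \<in> X. weighted_split_dist \<S> \<omega> u x = weighted_split_dist \<S> \<omega> v x}"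
    and "E \<subset> X" "S \<in> \<S>"
  shows "\<exists>A\<in>S. nested X A E"
proof -
  define f where "f = dist_diff u v"
  have less_iff: "f x < f y \<longleftrightarrow> (\<exists>A\<in>chain u v. x \<in> A \<and> y \<notin> A)" if "x \<in> X" "y \<in> X" for x y
    using dist_diff_less_iff[OF assms(1,2) that] by (simp add: f_def)
  have E: "E = {x \<in> X. f x = 0}"
    using assms(3) by (auto simp: f_def)
  have fuv: "f v = - f u"
    using weighted_split_dist_commute[of \<S> \<omega> u v] weighted_split_dist_self assms(1,2)
    by (simp add: f_def)
  define L M where "L = {x \<in> X. f x < 0}" and "M = {x \<in> X. f x \<le> 0}"
  \<comment> \<open>If no chain block existed, \<open>f\<close> would be constant; with
    \<open>f v = - f u\<close> it would vanish and \<open>E\<close> would be all of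
    \<open>X\<close>. The strict inequality forces \<open>f u < 0 < f v\<close>, which makes
    \<open>L\<close> and \<open>M\<close> non-empty and proper.\<close>
  have "f u < f v"
  proof (rule ccontr)
    assume "\<not> f u < f v"
    then have "chain u v = {}"
      using less_iff[OF assms(1,2)] by (auto simp: chain_def)
    then have const: "f x = f y" if "x \<in> X" "y \<in> X" for x y
      using less_iff[of x y] less_iff[of y x] that by auto
    have "f u = 0"
      using const[OF assms(1,2)] fuv by simp
    then have "E = X"
      using const[OF _ assms(1)] E by auto
    with assms(4) show False by simp
  qed
  then have "f u < 0" "f v > 0"
    using fuv by auto
  then have L: "L \<in> chain u v" and M: "M \<in> chain u v"
    using assms(1,2) unfolding L_def M_def f_def
    by (intro sublevel_in_chain; force)+
  have EML: "E = M - L"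
    unfolding E L_def M_def by auto
  have LM: "L \<subseteq> M" "M \<subseteq> X"
    unfolding L_def M_def by auto
  show ?thesis
  proof (cases "\<exists>A\<in>S. A \<in> chain u v")
    case True
    then obtain A where A: "A \<in> S" "A \<in> chain u v" by blast
    \<comment> \<open>A chain block cannot separate two points at which \<open>f\<close> has the
      same value.\<close>
    have "A \<inter> E = {} \<or> E \<subseteq> A"
    proof (rule ccontr)
      assume "\<not> ?thesis"
      then obtain x y where "x \<in> A" "x \<in> E" "y \<in> E" "y \<notin> A" by blast
      then have "f x < f y" using less_iff A(2) E by blast
      then show False using \<open>x \<in> E\<close> \<open>y \<in> E\<close> E by simp
    qed
    then show ?thesis
      using A(1) unfolding nested_def by blast
  next
    case False
    obtain A where A: "A \<in> S" "u \<in> A"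
      using is_split_obtain_block[OF split[OF assms(5)] assms(1)] .
    then have "v \<in> A"
      using False assms(5) by (auto simp: chain_def)
    have "nested X A L" "nested X A M"
      using compatible_nested[OF compat split assms(5) chain_block(1)[OF L] A(1)]
        compatible_nested[OF compat split assms(5) chain_block(1)[OF M] A(1)] by auto
    moreover have "u \<in> L" "u \<in> M" "v \<notin> L" "v \<notin> M"
      using L M by (auto simp: chain_def)
    \<comment> \<open>Since \<open>A\<close> contains both \<open>u\<close> and \<open>v\<close>,
      each of \<open>L\<close> and \<open>M\<close> is contained in \<open>A\<close> or covers
      \<open>X\<close> together with \<open>A\<close>. If \<open>M\<close> is inside
      \<open>A\<close>, or \<open>L\<close> and \<open>A\<close> cover \<open>X\<close>, then
      \<open>E\<close> is inside \<open>A\<close>. Otherwise \<open>L\<close> and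
      \<open>X - M\<close> are inside \<open>A\<close>, so \<open>A\<close> and \<open>E\<close>
      cover \<open>X\<close>.\<close>
    ultimately have "nested X A E"
      using A(2) \<open>v \<in> A\<close> LM unfolding nested_def EML by blast
    then show ?thesis
      using A(1) by blast
  qed
qed

end

section \<open>Collecting the coefficients\<close>

text \<open>Different pairs of points may induce the same split, so its weight has to count them; a
  split induced by no pair gets weight 0.\<close>

lemma sum_split_dist_collect:
  assumes "finite \<S>" "finite I" "g ` I \<subseteq> \<S>"
  shows "(\<Sum>i\<in>I. c * split_dist (g i) x y)
    = (\<Sum>S\<in>\<S>. c * card {i \<in> I. g i = S} * split_dist S x y)"
proof -
  have "(\<Sum>i\<in>I. c * split_dist (g i) x y)
      = (\<Sum>S\<in>\<S>. \<Sum>i\<in>{i \<in> I. g i = S}. c * split_dist (g i) x y)"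
    by (rule sum.group[OF assms(2,1,3), symmetric])
  also have "\<dots> = (\<Sum>S\<in>\<S>. c * card {i \<in> I. g i = S} * split_dist S x y)"
    by (intro sum.cong) auto
  finally show ?thesis .
qed

lemma equidistant_pair: "equidistant X D {u, v} = {x \<in> X. D u x = D v x}"
  by (auto simp: equidistant_def)

theorem theorem1:
  fixes X :: "'a set" and \<S> :: "'a set set set" and \<omega> :: "'a set set \<Rightarrow> real"
    and p q :: real and D :: "'a \<Rightarrow> 'a \<Rightarrow> real"
  assumes "finite X" and "card X \<ge> 2"
    and "q \<ge> p / 2" and "p / 2 > 0"
    and "maximum_compatible X \<S>"
    and "\<And>S. S \<in> \<S> \<Longrightarrow> \<omega> S > 0"
    and "D = weighted_split_dist \<S> \<omega>"
  shows "\<exists>\<omega>' :: 'a set set \<Rightarrow> real.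
           (\<forall>S\<in>\<S>. \<omega>' S \<ge> 0) \<and>
           (\<forall>x\<in>X. \<forall>y\<in>X. order_distance X p q D x y = weighted_split_dist \<S> \<omega>' x y)"
proof -
  have split: "is_split X S" if "S \<in> \<S>" for S
    using assms(5) that by (auto simp: maximum_compatible_def split_system_def)
  have finS: "finite \<S>"
    using assms(2,5) by (intro card_ge_0_finite) (simp add: maximum_compatible_def)
  interpret weighted_compatible_system X \<S> \<omega>
    using assms(1,5,6) split finS
    by unfold_locales (auto simp: maximum_compatible_def)
  define I where "I = {(u, v) \<in> X \<times> X. u \<noteq> v \<and> {} \<subset> closer X D u v \<and> closer X D u v \<subset> X}"
  define J where "J = {P. P \<subseteq> X \<and> card P = 2 \<and> {} \<subset> equidistant X D P \<and> equidistant X D P \<subset> X}"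
  define g where "g = (\<lambda>(u, v). {closer X D u v, X - closer X D u v})"
  define h where "h = (\<lambda>P. {equidistant X D P, X - equidistant X D P})"
  have g: "g ` I \<subseteq> \<S>"
    using closer_split unfolding I_def g_def assms(7) by auto
  have h: "h ` J \<subseteq> \<S>"
  proof (rule image_subsetI)
    fix P assume "P \<in> J"
    obtain u v where P: "P = {u, v}"
      using \<open>P \<in> J\<close> by (auto simp: J_def card_2_iff)
    then have "u \<in> X" "v \<in> X" "equidistant X D P \<noteq> {}" "equidistant X D P \<subset> X"
      using \<open>P \<in> J\<close> by (auto simp: J_def)
    then show "h P \<in> \<S>"
      using equidistant_nested[of u v "equidistant X D P"] unfolding h_def
      by (intro maximum_compatible_maximal[OF assms(1,2,5)])
        (auto simp: P equidistant_pair assms(7))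
  qed
  have finI: "finite I" and finJ: "finite J"
    using assms(1) by (auto simp: I_def J_def intro: rev_finite_subset[of "X \<times> X"])
  \<comment> \<open>The factors \<open>p / 2\<close> and \<open>q - p / 2\<close> are non-negative
    by hypothesis, hence so is every weight.\<close>
  define \<omega>' where
    "\<omega>' S = p / 2 * card {i \<in> I. g i = S} + (q - p / 2) * card {P \<in> J. h P = S}" for S
  have "\<omega>' S \<ge> 0" for S
    using assms(3,4) by (simp add: \<omega>'_def)
  moreover have "order_distance X p q D x y = weighted_split_dist \<S> \<omega>' x y" for x y
  proof -
    have "order_distance X p q D x y
        = (\<Sum>i\<in>I. p / 2 * split_dist (g i) x y) + (\<Sum>P\<in>J. (q - p / 2) * split_dist (h P) x y)"
      unfolding order_distance_def I_def J_def g_def h_def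
      by (intro arg_cong2[of _ _ _ _ "(+)"] sum.cong) auto
    also have "\<dots> = weighted_split_dist \<S> \<omega>' x y"
      unfolding weighted_split_dist_def \<omega>'_def sum_split_dist_collect[OF finS finI g]
        sum_split_dist_collect[OF finS finJ h]
      by (simp only: sum.distrib distrib_right)
    finally show ?thesis .
  qed
  ultimately show ?thesis
    by blast
qed

end
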